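(* For every real $\gamma>0$ the following holds for all sufficiently large integers $n$. If $H$ is a $3$-graph on $n$ vertices which is induced $K_4^-$-free and satisfies $\delta_2(H)\ge (1/6+\gamma)n$, then $H$ contains a matching that covers all but at most $5/\gamma$ vertices of $H$.
   Context: A $3$-graph $H$ has edge set a family of $3$-element subsets of $V(H)$. $K_4^-$ is the unique (up to isomorphism) $3$-graph with $4$ vertices and $3$ edges. $H$ is induced $K_4^-$-free if there is no $4$-set $W\subseteq V(H)$ such that exactly $3$ of the $3$-subsets of $W$ are edges of $H$. For distinct vertices $x,y$, $\deg_H(\{x,y\})$ is the number of vertices $z$ with $\{x,y,z\}\in E(H)$, and $\delta_2(H)$ is the minimum of this over all pairs. A matching is a set of pairwise vertex-disjoint edges. *)

theory Defs
  imports Complex_Main "HOL-Library.Ramsey"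
begin

text \<open>Here \<open>nsets V k\<close> (from the Ramsey theory) is the set of finite \<open>k\<close>-element
  subsets of \<open>V\<close>.  A 3-graph is given by its vertex set \<open>V\<close> and its edge set \<open>E\<close>.\<close>

definition three_graph :: "'a set \<Rightarrow> 'a set set \<Rightarrow> bool" where
  "three_graph V E \<longleftrightarrow> finite V \<and> E \<subseteq> nsets V 3"

definition induced_K4_minus_free :: "'a set \<Rightarrow> 'a set set \<Rightarrow> bool" where
  "induced_K4_minus_free V E \<longleftrightarrow> \<not> (\<exists>W \<in> nsets V 4. card (nsets W 3 \<inter> E) = 3)"

definition pair_degree :: "'a set \<Rightarrow> 'a set set \<Rightarrow> 'a \<Rightarrow> 'a \<Rightarrow> nat" where
  "pair_degree V E x y = card {z \<in> V. {x, y, z} \<in> E}"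

text \<open>Only meaningful when \<open>V\<close> is finite with at least two vertices; otherwise \<open>Min\<close> is
  applied to an empty or possibly infinite set.\<close>

definition min_pair_degree :: "'a set \<Rightarrow> 'a set set \<Rightarrow> nat" where
  "min_pair_degree V E = Min {pair_degree V E x y | x y. x \<in> V \<and> y \<in> V \<and> x \<noteq> y}"

definition matching_in :: "'a set set \<Rightarrow> 'a set set \<Rightarrow> bool" where
  "matching_in E M \<longleftrightarrow> M \<subseteq> E \<and> pairwise disjnt M"

end

theory Submission
  imports Defs
begin

text \<open>Let \<open>M\<close> be a maximum matching, \<open>U\<close> its set of uncovered vertices and \<open>u = card U\<close>.
  By maximality \<open>U\<close> spans no edge, so every pair inside \<open>U\<close> has all its neighbours in \<open>\<Union>M\<close>,
  and some \<open>e \<in> M\<close> satisfies \<open>\<Sum>a\<in>e. |L a| \<ge> (1/2 + 3\<gamma>) (u choose 2)\<close>, where \<open>L a\<close> is the link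
  graph of \<open>a\<close> on \<open>U\<close>.  A triangle in \<open>L a\<close> would give an induced \<open>K\<^sub>4\<^sup>-\<close>, so Mantel's theorem
  yields \<open>|L a| \<le> u\<^sup>2/4\<close>.  If two vertices of \<open>e\<close> have nonempty links, maximality forces edges of
  different links to meet, so the three links have only \<open>O(u)\<close> edges; otherwise only one link
  contributes.  Both cases contradict \<open>u > 5/\<gamma>\<close>.\<close>

section \<open>Link graphs and Mantel's theorem\<close>

definition link_on :: "'a set set \<Rightarrow> 'a set \<Rightarrow> 'a \<Rightarrow> 'a set set" where
  "link_on E U a = {p \<in> nsets U 2. insert a p \<in> E}"

lemma link_on_subset: "link_on E U a \<subseteq> nsets U 2"
  by (auto simp: link_on_def)

lemma card_edges_at_le:
  assumes "finite U" "G \<subseteq> nsets U 2"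
  shows "card {e \<in> G. v \<in> e} \<le> card {w \<in> U. {v, w} \<in> G}"
proof -
  have "{e \<in> G. v \<in> e} \<subseteq> (\<lambda>w. {v, w}) ` {w \<in> U. {v, w} \<in> G}"
  proof
    fix e assume e: "e \<in> {e \<in> G. v \<in> e}"
    then have "e \<in> nsets U 2" using assms by auto
    then obtain x y where "e = {x, y}" "x \<in> U" "y \<in> U"
      by (rule nsets2_E)
    with e obtain w where "w \<in> U" "e = {v, w}" by blast
    with e show "e \<in> (\<lambda>w. {v, w}) ` {w \<in> U. {v, w} \<in> G}"
      by auto
  qed
  then show ?thesis
    using assms(1) by (intro surj_card_le[of _ _ "\<lambda>w. {v, w}"]) auto
qed

text \<open>Let \<open>x\<close> have maximum degree d. Its neighbourhood \<open>N x\<close> is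
  independent because there is no triangle, so every edge has an end in \<open>U - N x\<close>.
  Adding up the degrees there, each at most d, gives at most (|U| - d) d edges, and this product is
  at most |U|^2 / 4.\<close>

lemma Mantel:
  assumes fin: "finite U" and G: "G \<subseteq> nsets U 2"
    and tf: "\<And>x y z. {x, y} \<in> G \<Longrightarrow> {x, z} \<in> G \<Longrightarrow> {y, z} \<notin> G"
  shows "4 * card G \<le> (card U)\<^sup>2"
proof (cases "U = {}")
  case True
  then have "nsets U 2 = {}" by (auto simp: nsets_def)
  then show ?thesis using G by auto
next
  case False
  define N where "N v = {w \<in> U. {v, w} \<in> G}" for v
  have finN: "finite (N v)" for v using fin by (simp add: N_def)
  obtain x where x: "x \<in> U" and max: "\<And>v. v \<in> U \<Longrightarrow> card (N v) \<le> card (N x)"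
  proof -
    have "Max ((\<lambda>v. card (N v)) ` U) \<in> (\<lambda>v. card (N v)) ` U"
      using fin False by (intro Max_in) auto
    then obtain x where "x \<in> U" "Max ((\<lambda>v. card (N v)) ` U) = card (N x)" by auto
    moreover have "card (N v) \<le> Max ((\<lambda>v. card (N v)) ` U)" if "v \<in> U" for v
      using fin that by (intro Max_ge) auto
    ultimately show ?thesis using that by auto
  qed
  let ?d = "card (N x)"
  have NU: "N x \<subseteq> U" by (auto simp: N_def)
  have finG: "finite G" using G fin finite_imp_finite_nsets finite_subset by blast
  have sub: "G \<subseteq> (\<Union>v\<in>U - N x. {e \<in> G. v \<in> e})"
  proof
    fix e assume e: "e \<in> G"
    then obtain y z where yz: "e = {y, z}" "y \<in> U" "z \<in> U"
      using G by (meson nsets2_E subsetD)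
    then have "y \<notin> N x \<or> z \<notin> N x"
      using e tf[of x y z] unfolding N_def by blast
    with e yz show "e \<in> (\<Union>v\<in>U - N x. {e \<in> G. v \<in> e})" by auto
  qed
  have "card G \<le> card (\<Union>v\<in>U - N x. {e \<in> G. v \<in> e})"
    using sub finG fin by (intro card_mono) auto
  also have "\<dots> \<le> (\<Sum>v\<in>U - N x. card {e \<in> G. v \<in> e})"
    using fin by (intro card_UN_le) auto
  also have "\<dots> \<le> (\<Sum>v\<in>U - N x. ?d)"
  proof (rule sum_mono)
    fix v assume "v \<in> U - N x"
    then show "card {e \<in> G. v \<in> e} \<le> ?d"
      using card_edges_at_le[OF fin G, of v] max[of v] by (simp add: N_def)
  qed
  also have "\<dots> = (card U - ?d) * ?d"
    using card_Diff_subset[OF finN NU] by simp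
  finally have "card G \<le> (card U - ?d) * ?d" .
  \<comment> \<open>Over the integers the subtraction is not truncated;
    \<open>N x \<subseteq> U\<close> makes the two versions agree. The final bound is then the fact
    that (|U| - 2d)^2 is nonnegative.\<close>
  then have "int (card G) \<le> (int (card U) - int ?d) * int ?d"
    using card_mono[OF fin NU] by (metis of_nat_diff of_nat_le_iff of_nat_mult)
  moreover have "4 * ((int (card U) - int ?d) * int ?d) \<le> (int (card U))\<^sup>2"
    using zero_le_power2[of "int (card U) - 2 * int ?d"]
    by (simp add: power2_eq_square algebra_simps)
  ultimately have "4 * int (card G) \<le> (int (card U))\<^sup>2" by linarith
  then show ?thesis
    by (metis of_nat_le_iff of_nat_mult of_nat_numeral of_nat_power)
qed

section \<open>Link sizes and the double count\<close>

lemma induced_K4_minus: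
  assumes "distinct [a, x, y, z]" "{a, x, y} \<in> E" "{a, x, z} \<in> E" "{a, y, z} \<in> E" "{x, y, z} \<notin> E"
  shows "card (nsets {a, x, y, z} 3 \<inter> E) = 3"
proof -
  let ?W = "{a, x, y, z}"
  have "nsets ?W 3 \<subseteq> {{a, x, y}, {a, x, z}, {a, y, z}, {x, y, z}}"
  proof
    fix p assume "p \<in> nsets ?W 3"
    then have p: "p \<subseteq> ?W" "card p = 3" "finite p" by (auto simp: nsets_def)
    \<comment> \<open>A triple in a 4-set is determined by the one vertex it omits, which leaves
      four candidates.\<close>
    then have "card (?W - p) = 1" using assms(1) by (simp add: card_Diff_subset)
    then obtain w where w: "?W - p = {w}" by (auto simp: card_1_singleton_iff)
    have "?W - (?W - p) = p" by (rule double_diff[OF p(1) order_refl])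
    then have "p = ?W - {w}" unfolding w by (rule sym)
    moreover have "w \<in> ?W" using equalityD2[OF w] by (meson DiffD1 insert_subset)
    then have "w = a \<or> w = x \<or> w = y \<or> w = z" by simp
    moreover have "?W - {a} = {x, y, z}" "?W - {x} = {a, y, z}" "?W - {y} = {a, x, z}"
      "?W - {z} = {a, x, y}"
      using assms(1) by auto
    ultimately show "p \<in> {{a, x, y}, {a, x, z}, {a, y, z}, {x, y, z}}"
      by (metis insertI1 insertI2)
  qed
  moreover have "{{a, x, y}, {a, x, z}, {a, y, z}} \<subseteq> nsets ?W 3"
    using assms(1) by (auto simp: nsets_def)
  ultimately have "nsets ?W 3 \<inter> E = {{a, x, y}, {a, x, z}, {a, y, z}}"
    using assms by auto
  moreover have "{a, x, y} \<noteq> {a, x, z}" "{a, x, y} \<noteq> {a, y, z}" "{a, x, z} \<noteq> {a, y, z}"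
    using assms(1) by auto
  ultimately show ?thesis by simp
qed

text \<open>A triangle \<open>x\<close>, \<open>y\<close>, \<open>z\<close> in the link of
  \<open>a\<close> yields three edges through \<open>a\<close>, while \<open>{x, y, z}\<close> lies
  inside \<open>U\<close> and is no edge: an induced \<open>K_4^-\<close>. So the link is
  triangle-free and Mantel's theorem applies.\<close>

lemma card_link_on_le:
  assumes free: "induced_K4_minus_free V E" and fin: "finite U" and "U \<subseteq> V" "a \<in> V - U"
    and indep: "\<And>e. e \<in> E \<Longrightarrow> \<not> e \<subseteq> U"
  shows "4 * card (link_on E U a) \<le> (card U)\<^sup>2"
proof (rule Mantel[OF fin link_on_subset])
  fix x y z assume xy: "{x, y} \<in> link_on E U a" and xz: "{x, z} \<in> link_on E U a"
  show "{y, z} \<notin> link_on E U a"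
  proof
    assume yz: "{y, z} \<in> link_on E U a"
    have U: "x \<in> U" "y \<in> U" "z \<in> U" and d: "x \<noteq> y" "x \<noteq> z" "y \<noteq> z"
      using xy xz yz by (auto simp: link_on_def)
    have dist: "distinct [a, x, y, z]" using U d assms(4) by auto
    have "{a, x, y} \<in> E" "{a, x, z} \<in> E" "{a, y, z} \<in> E"
      using xy xz yz by (simp_all add: link_on_def)
    moreover have "{x, y, z} \<notin> E" using indep U by blast
    ultimately have "card (nsets {a, x, y, z} 3 \<inter> E) = 3"
      by (rule induced_K4_minus[OF dist])
    moreover have "{a, x, y, z} \<in> nsets V 4"
      using dist U assms(3,4) by (auto simp: nsets_def)
    ultimately show False using free by (auto simp: induced_K4_minus_free_def)
  qed
qed

text \<open>Each member of \<open>G\<close> contains one of the two ends of \<open>p\<close>, and a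
  vertex of \<open>U\<close> lies in at most |U| - 1 pairs.\<close>

lemma card_pairs_meeting_le:
  assumes fin: "finite U" and p: "p \<in> nsets U 2" and G: "G \<subseteq> nsets U 2"
    and meet: "\<And>q. q \<in> G \<Longrightarrow> p \<inter> q \<noteq> {}"
  shows "card G \<le> 2 * (card U - 1)"
proof -
  have deg: "card {e \<in> G. v \<in> e} \<le> card U - 1" if "v \<in> U" for v
  proof -
    have "{w \<in> U. {v, w} \<in> G} \<subseteq> U - {v}" using G by (auto simp: nsets_def)
    then have "card {w \<in> U. {v, w} \<in> G} \<le> card (U - {v})"
      using fin by (intro card_mono) auto
    then show ?thesis using card_edges_at_le[OF fin G, of v] that fin by simp
  qed
  obtain x y where xy: "p = {x, y}" "x \<in> U" "y \<in> U"
    using p by (rule nsets2_E)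
  have "finite G" using G fin finite_imp_finite_nsets finite_subset by blast
  moreover have "G \<subseteq> {e \<in> G. x \<in> e} \<union> {e \<in> G. y \<in> e}"
    using meet xy by auto
  ultimately have "card G \<le> card ({e \<in> G. x \<in> e} \<union> {e \<in> G. y \<in> e})"
    by (intro card_mono) auto
  also have "\<dots> \<le> card {e \<in> G. x \<in> e} + card {e \<in> G. y \<in> e}"
    by (rule card_Un_le)
  finally show ?thesis using deg[of x] deg[of y] xy by simp
qed

text \<open>Both sides count the incidences between pairs \<open>p\<close> in \<open>U\<close> and
  vertices \<open>a\<close> with \<open>insert a p\<close> an edge. Such an \<open>a\<close> is
  never in \<open>U\<close>, since the edge would then lie inside \<open>U\<close>.\<close>

lemma sum_pair_degree:
  assumes fin: "finite V" and "U \<subseteq> V" and indep: "\<And>e. e \<in> E \<Longrightarrow> \<not> e \<subseteq> U"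
  shows "(\<Sum>p\<in>nsets U 2. card {z \<in> V. insert z p \<in> E}) = (\<Sum>a\<in>V - U. card (link_on E U a))"
proof -
  have finU: "finite (nsets U 2)"
    using assms finite_subset finite_imp_finite_nsets by blast
  have "(\<Sum>p\<in>nsets U 2. card {z \<in> V. insert z p \<in> E})
      = (\<Sum>p\<in>nsets U 2. card {z \<in> V - U. insert z p \<in> E})"
  proof (rule sum.cong[OF refl])
    fix p assume "p \<in> nsets U 2"
    then have "{z \<in> V. insert z p \<in> E} = {z \<in> V - U. insert z p \<in> E}"
      using indep by (auto simp: nsets_def)
    then show "card {z \<in> V. insert z p \<in> E} = card {z \<in> V - U. insert z p \<in> E}" by simp
  qed
  also have "\<dots> = (\<Sum>a\<in>V - U. card {p \<in> nsets U 2. insert a p \<in> E})"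
    using sum_multicount_gen[OF finU, of "V - U" "\<lambda>p a. insert a p \<in> E"
      "\<lambda>a. card {p \<in> nsets U 2. insert a p \<in> E}"] fin by simp
  finally show ?thesis by (simp add: link_on_def)
qed

section \<open>Matchings of maximum size\<close>

lemma three_graph_finite_edges:
  assumes "three_graph V E" shows "finite E"
  using assms unfolding three_graph_def
  by (meson finite_imp_finite_nsets finite_subset)

lemma maximum_matching_exists:
  assumes "finite E"
  obtains M where "matching_in E M" "\<And>M'. matching_in E M' \<Longrightarrow> card M' \<le> card M"
proof -
  have "matching_in E {}" by (simp add: matching_in_def)
  \<comment> \<open>The \<open>+ 1\<close> provides the strict upper bound that
    \<open>ex_has_greatest_nat\<close> asks for.\<close>
  moreover have "\<forall>M. matching_in E M \<longrightarrow> card M < card E + 1"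
    using assms by (auto simp: matching_in_def less_Suc_eq_le intro: card_mono)
  ultimately have "\<exists>M. matching_in E M \<and> (\<forall>M'. matching_in E M' \<longrightarrow> card M' \<le> card M)"
    by (rule ex_has_greatest_nat)
  then show ?thesis using that by blast
qed

lemma card_Union_matching:
  assumes "three_graph V E" "matching_in E M"
  shows "card (\<Union>M) = 3 * card M"
proof -
  have "card (\<Union>M) = (\<Sum>e\<in>M. card e)"
    using assms by (intro card_Union_disjoint) (auto simp: matching_in_def three_graph_def nsets_def)
  also have "\<dots> = (\<Sum>e\<in>M. 3)"
    using assms by (intro sum.cong) (auto simp: matching_in_def three_graph_def nsets_def)
  finally show ?thesis by simp
qed

section \<open>Links of the edges of a maximum matching\<close>

context
  fixes V :: "'a set" and E M :: "'a set set" and U :: "'a set"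
  assumes graph: "three_graph V E" and matching: "matching_in E M"
    and maximum: "\<And>M'. matching_in E M' \<Longrightarrow> card M' \<le> card M"
    and U_def: "U = V - \<Union>M"
begin

lemma finite_matching: "finite M"
  using three_graph_finite_edges[OF graph] matching finite_subset by (auto simp: matching_in_def)

lemma edge_nonempty: "e \<in> E \<Longrightarrow> e \<noteq> {}"
  using graph by (auto simp: three_graph_def nsets_def)

lemma uncovered_independent:
  assumes "e \<in> E" shows "\<not> e \<subseteq> U"
proof
  assume "e \<subseteq> U"
  then have disj: "e \<inter> f = {}" if "f \<in> M" for f using that by (auto simp: U_def)
  \<comment> \<open>Were \<open>e\<close> in \<open>M\<close>, it would be disjoint from itself,
    hence empty. So adding \<open>e\<close> really enlarges \<open>M\<close>.\<close>
  then have "e \<notin> M" using edge_nonempty[OF assms] by blast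
  have "matching_in E (insert e M)"
    using matching assms disj by (auto simp: matching_in_def pairwise_insert disjnt_def)
  then show False using maximum[of "insert e M"] \<open>e \<notin> M\<close> finite_matching by simp
qed

text \<open>If \<open>p\<close> and \<open>q\<close> were disjoint, exchanging \<open>e\<close> for
  the two edges \<open>insert a p\<close> and \<open>insert b q\<close> would give a matching with
  one more edge.\<close>

lemma links_cross_intersect:
  assumes e: "e \<in> M" and ab: "a \<in> e" "b \<in> e" "a \<noteq> b"
    and p: "p \<in> link_on E U a" and q: "q \<in> link_on E U b"
  shows "p \<inter> q \<noteq> {}"
proof
  assume pq: "p \<inter> q = {}"
  have sub: "p \<subseteq> U" "q \<subseteq> U" using p q by (auto simp: link_on_def nsets_def)
  let ?f = "insert a p" and ?g = "insert b q"
  have E: "?f \<in> E" "?g \<in> E" using p q by (auto simp: link_on_def)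
  have eU: "e \<inter> U = {}" using e by (auto simp: U_def)
  have fg: "?f \<inter> ?g = {}" using ab pq sub eU by auto
  then have neq: "?f \<noteq> ?g" by auto
  have disj: "h \<inter> ?f = {} \<and> h \<inter> ?g = {}" if "h \<in> M - {e}" for h
  proof -
    have "h \<inter> e = {}" using that e matching
      by (auto simp: matching_in_def pairwise_def disjnt_def)
    moreover have "h \<inter> U = {}" using that by (auto simp: U_def)
    ultimately show ?thesis using ab sub by auto
  qed
  then have notin: "?f \<notin> M - {e}" "?g \<notin> M - {e}" by blast+
  have "pairwise disjnt (M - {e})"
    using matching by (auto simp: matching_in_def intro: pairwise_subset)
  moreover have "\<forall>h\<in>M - {e}. disjnt ?f h \<and> disjnt h ?f \<and> disjnt ?g h \<and> disjnt h ?g"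
    using disj unfolding disjnt_def by (metis Int_commute)
  moreover have "disjnt ?f ?g" "disjnt ?g ?f"
    using fg unfolding disjnt_def by (metis Int_commute)+
  ultimately have "pairwise disjnt (insert ?f (insert ?g (M - {e})))"
    unfolding pairwise_insert by blast
  then have "matching_in E (insert ?f (insert ?g (M - {e})))"
    using E matching by (auto simp: matching_in_def)
  moreover have "card (insert ?f (insert ?g (M - {e}))) = card M + 1"
    using notin neq finite_matching e card_Suc_Diff1[OF finite_matching e] by simp
  ultimately show False using maximum[of "insert ?f (insert ?g (M - {e}))"] by linarith
qed

text \<open>The factor 4 clears the denominator in Mantel's bound. With two nonempty links, each of
  the three links has at most 2(|U| - 1) pairs, whence 24 = 4 * 3 * 2. With at most one, Mantel's
  bound for it is a bound for the whole sum.\<close>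

lemma sum_card_links_le:
  assumes free: "induced_K4_minus_free V E" and e: "e \<in> M"
  shows "4 * (\<Sum>a\<in>e. card (link_on E U a)) \<le> max ((card U)\<^sup>2) (24 * (card U - 1))"
proof -
  have "e \<in> nsets V 3" using e matching graph by (auto simp: matching_in_def three_graph_def)
  then have eV: "e \<subseteq> V" "finite e" "card e = 3" by (auto simp: nsets_def)
  have finU: "finite U" using graph by (simp add: U_def three_graph_def)
  show ?thesis
  proof (cases "\<exists>a\<in>e. \<exists>b\<in>e. a \<noteq> b \<and> link_on E U a \<noteq> {} \<and> link_on E U b \<noteq> {}")
    case True
    then obtain a b where ab: "a \<in> e" "b \<in> e" "a \<noteq> b" "link_on E U a \<noteq> {}" "link_on E U b \<noteq> {}"
      by blast
    have "card (link_on E U c) \<le> 2 * (card U - 1)" if c: "c \<in> e" for c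
    proof -
      \<comment> \<open>At least one of \<open>a\<close> and \<open>b\<close> differs from
        \<open>c\<close>; a pair in its link must meet every pair in the link of
        \<open>c\<close>.\<close>
      obtain d where d: "d \<in> e" "d \<noteq> c" "link_on E U d \<noteq> {}" using ab by metis
      then obtain p where p: "p \<in> link_on E U d" by blast
      show ?thesis
      proof (rule card_pairs_meeting_le[OF finU _ link_on_subset])
        show "p \<in> nsets U 2" using subsetD[OF link_on_subset p] .
        show "p \<inter> q \<noteq> {}" if "q \<in> link_on E U c" for q
          using links_cross_intersect[OF e d(1) c d(2) p that] .
      qed
    qed
    then have "(\<Sum>a\<in>e. card (link_on E U a)) \<le> card e * (2 * (card U - 1))"
      using sum_bounded_above[of e "\<lambda>a. card (link_on E U a)" "2 * (card U - 1)"] by simp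
    then show ?thesis using eV by simp
  next
    case False
    obtain a where a: "a \<in> e" "\<forall>b\<in>e - {a}. link_on E U b = {}"
    proof (cases "\<exists>a\<in>e. link_on E U a \<noteq> {}")
      case True
      with False that show ?thesis by blast
    next
      case False
      moreover have "e \<noteq> {}" using eV by auto
      ultimately show ?thesis using that by blast
    qed
    have "(\<Sum>b\<in>e. card (link_on E U b)) = card (link_on E U a)"
      using a eV by (subst sum.remove[of e a]) auto
    moreover have "4 * card (link_on E U a) \<le> (card U)\<^sup>2"
      using a e eV finU uncovered_independent by (intro card_link_on_le[OF free]) (auto simp: U_def)
    ultimately show ?thesis by simp
  qed
qed

lemma sum_degrees_uncovered_le:
  assumes "induced_K4_minus_free V E"
  shows "4 * (\<Sum>p\<in>nsets U 2. card {z \<in> V. insert z p \<in> E})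
    \<le> card M * max ((card U)\<^sup>2) (24 * (card U - 1))"
proof -
  have fin: "finite V" using graph by (simp add: three_graph_def)
  have MV: "\<Union>M = V - U"
    using matching graph by (auto simp: U_def matching_in_def three_graph_def nsets_def)
  have "(\<Sum>p\<in>nsets U 2. card {z \<in> V. insert z p \<in> E}) = (\<Sum>a\<in>\<Union>M. card (link_on E U a))"
    unfolding MV using fin uncovered_independent
    by (intro sum_pair_degree) (auto simp: U_def)
  also have "\<dots> = (\<Sum>e\<in>M. \<Sum>a\<in>e. card (link_on E U a))"
    using matching graph
    by (subst sum.Union_disjoint)
      (auto simp: matching_in_def three_graph_def nsets_def pairwise_def disjnt_def)
  finally have "4 * (\<Sum>p\<in>nsets U 2. card {z \<in> V. insert z p \<in> E})
      = (\<Sum>e\<in>M. 4 * (\<Sum>a\<in>e. card (link_on E U a)))"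
    by (simp add: sum_distrib_left)
  also have "\<dots> \<le> card M * max ((card U)\<^sup>2) (24 * (card U - 1))"
    using sum_bounded_above[of M "\<lambda>e. 4 * (\<Sum>a\<in>e. card (link_on E U a))"]
      sum_card_links_le[OF assms] by simp
  finally show ?thesis .
qed

end

section \<open>Minimum pair degree and the final contradiction\<close>

lemma min_pair_degree_le:
  assumes "finite V" "x \<in> V" "y \<in> V" "x \<noteq> y"
  shows "min_pair_degree V E \<le> pair_degree V E x y"
proof -
  let ?D = "{pair_degree V E x y | x y. x \<in> V \<and> y \<in> V \<and> x \<noteq> y}"
  have "?D \<subseteq> (\<lambda>(x, y). pair_degree V E x y) ` (V \<times> V)" by auto
  then have "finite ?D" using assms(1) finite_subset by blast
  then show ?thesis unfolding min_pair_degree_def using assms by (intro Min_le) auto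
qed

lemma theorem3p1_bound:
  fixes V :: "'a set"
  assumes \<gamma>: "\<gamma> > 0" and graph: "three_graph V E" and n: "card V \<ge> 2"
    and free: "induced_K4_minus_free V E"
    and deg: "real (min_pair_degree V E) \<ge> (1/6 + \<gamma>) * real (card V)"
  shows "\<exists>M. matching_in E M \<and> real (card (V - \<Union>M)) \<le> 5 / \<gamma>"
proof -
  let ?n = "real (card V)"
  have fin: "finite V" using graph by (simp add: three_graph_def)
  obtain M where M: "matching_in E M" "\<And>M'. matching_in E M' \<Longrightarrow> card M' \<le> card M"
    using maximum_matching_exists[OF three_graph_finite_edges[OF graph]] by blast
  define U where "U = V - \<Union>M"
  define u where "u = real (card U)"
  have "u \<le> 5 / \<gamma>"
  proof (rule ccontr)
    assume "\<not> u \<le> 5 / \<gamma>"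
    then have u\<gamma>: "5 < u * \<gamma>" using \<gamma> by (simp add: field_simps)
    obtain x y where xy: "x \<in> V" "y \<in> V" "x \<noteq> y"
      using n fin by (metis card_le_Suc0_iff_eq not_less_eq_eq numeral_2_eq_2)
    have "pair_degree V E x y \<le> card V"
      unfolding pair_degree_def using fin by (intro card_mono) auto
    \<comment> \<open>A pair degree is at most n, which forces \<gamma> < 1; then u \<ge> u\<gamma>
      > 5.\<close>
    then have "(1/6 + \<gamma>) * ?n \<le> 1 * ?n"
      using min_pair_degree_le[OF fin xy, of E] deg by linarith
    then have "\<gamma> < 1" using n by (subst (asm) mult_le_cancel_right) auto
    moreover have "0 \<le> u" by (simp add: u_def)
    ultimately have u5: "u > 5" using u\<gamma> \<gamma> mult_left_mono[of \<gamma> 1 u] by simp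
    then have Suc_U: "card U \<ge> 1" by (simp add: u_def)
    have finU: "finite U" using fin by (simp add: U_def)
    have cardp: "(1/6 + \<gamma>) * ?n \<le> real (card {z \<in> V. insert z p \<in> E})" if "p \<in> nsets U 2" for p
    proof -
      obtain x y where p: "p = {x, y}" "x \<in> U" "y \<in> U" "x \<noteq> y"
        using \<open>p \<in> nsets U 2\<close> by (rule nsets2_E)
      have "{z \<in> V. insert z p \<in> E} = {z \<in> V. {x, y, z} \<in> E}"
        by (auto simp: p insert_commute)
      then show ?thesis
        using min_pair_degree_le[OF fin, of x y E] p deg by (auto simp: pair_degree_def U_def)
    qed
    have card_pairs: "real (card (nsets U 2)) = u * (u - 1) / 2"
      using Suc_U by (simp add: card_nsets u_def choose_two real_of_nat_div of_nat_diff)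
    \<comment> \<open>Four times the degree sum over the pairs in \<open>U\<close> is estimated from
      below by the minimum degree and from above by the links of the at most n/3 edges of
      \<open>M\<close>.\<close>
    have "2 * (u * (u - 1)) * ((1/6 + \<gamma>) * ?n) = 4 * (u * (u - 1) / 2 * ((1/6 + \<gamma>) * ?n))"
      by simp
    also have "\<dots> \<le> 4 * (\<Sum>p\<in>nsets U 2. real (card {z \<in> V. insert z p \<in> E}))"
      unfolding card_pairs[symmetric] by (intro mult_left_mono sum_bounded_below cardp) simp_all
    also have "\<dots> = real (4 * (\<Sum>p\<in>nsets U 2. card {z \<in> V. insert z p \<in> E}))"
      by simp
    also have "\<dots> \<le> real (card M * max ((card U)\<^sup>2) (24 * (card U - 1)))"
      using sum_degrees_uncovered_le[OF graph M U_def free] by (simp only: of_nat_le_iff)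
    also have "\<dots> = real (card M) * max (u\<^sup>2) (24 * (u - 1))"
      using Suc_U by (simp add: u_def of_nat_diff of_nat_max)
    also have "\<dots> \<le> ?n / 3 * max (u\<^sup>2) (24 * (u - 1))"
    proof (rule mult_right_mono)
      have "card (\<Union>M) \<le> card V"
        using M graph fin
        by (intro card_mono) (auto simp: matching_in_def three_graph_def nsets_def)
      then show "real (card M) \<le> ?n / 3"
        using card_Union_matching[OF graph M(1)] by simp
    qed (use u5 in \<open>simp add: max_def\<close>)
    finally have "?n * (2 * (u * (u - 1)) * (1/6 + \<gamma>)) \<le> ?n * (max (u\<^sup>2) (24 * (u - 1)) / 3)"
      by (simp add: mult_ac)
    then have le: "2 * (u * (u - 1)) * (1/6 + \<gamma>) \<le> max (u\<^sup>2) (24 * (u - 1)) / 3"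
      using n by (subst (asm) mult_le_cancel_left) auto
    \<comment> \<open>Multiplied by 3, the left side of \<open>le\<close> is u(u - 1) + 6\<gamma>u(u
      - 1). Since u\<gamma> > 5, the second term exceeds 30(u - 1), which is enough against both
      entries of the maximum: u^2 - u(u - 1) = u is at most 30(u - 1), and 24 < 30.\<close>
    have "(u - 1) * 5 < (u - 1) * (u * \<gamma>)"
      using u\<gamma> u5 by (intro mult_strict_left_mono) auto
    then have "u * (u - 1) + 30 * (u - 1) < 3 * (2 * (u * (u - 1)) * (1/6 + \<gamma>))"
      by (simp add: algebra_simps)
    moreover have "max (u\<^sup>2) (24 * (u - 1)) \<le> u * (u - 1) + 30 * (u - 1)"
    proof (rule max.boundedI)
      show "u\<^sup>2 \<le> u * (u - 1) + 30 * (u - 1)"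
        using u5 by (simp add: power2_eq_square algebra_simps)
      show "24 * (u - 1) \<le> u * (u - 1) + 30 * (u - 1)"
        using u5 by (intro add_increasing) simp_all
    qed
    ultimately show False using le by linarith
  qed
  then show ?thesis using M(1) by (auto simp: u_def U_def)
qed

theorem theorem3p1:
  shows "\<forall>\<gamma>::real. \<gamma> > 0 \<longrightarrow>
    (\<exists>n0::nat. \<forall>n\<ge>n0. \<forall>(V :: 'a set) E.
       three_graph V E \<and> card V = n \<and> induced_K4_minus_free V E \<and>
       real (min_pair_degree V E) \<ge> (1/6 + \<gamma>) * real n \<longrightarrow>
       (\<exists>M. matching_in E M \<and> real (card (V - \<Union>M)) \<le> 5 / \<gamma>))"
  \<comment> \<open>The threshold \<open>n0 = 2\<close> serves every \<gamma>: it ensures that there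
    is a pair of distinct vertices.\<close>
  using theorem3p1_bound by blast

end
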